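(* For every prime power $q \equiv 1 \pmod{20}$, let $\alpha$ be a primitive element of $\mathbb{F}_q$, let $h = \alpha^{\frac{q-1}{5}}$, and let $\chi$ be the quadratic character of $\mathbb{F}_q$. Then there are infinitely many prime powers $q$ satisfying $q \equiv 1 \pmod{20}$ and $\chi(1+h) = -1$.
   Context: $\mathbb{F}_q$ is the finite field with $q$ elements and $\mathbb{F}_q^{\times}$ its multiplicative group. A primitive element of $\mathbb{F}_q$ is a generator of $\mathbb{F}_q^{\times}$. The quadratic character is given, for $a \in \mathbb{F}_q^{\times}$, by $\chi(a) = 1$ if $a$ is a nonzero square in $\mathbb{F}_q$ and $\chi(a) = -1$ otherwise. *)

theory Defs
  imports
    "HOL-Algebra.Multiplicative_Group"
    "HOL-Algebra.Generated_Groups"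
    "HOL-Number_Theory.Prime_Powers"
    "HOL-Number_Theory.Cong"
begin

definition primitive_element :: "('a, 'b) ring_scheme \<Rightarrow> 'a \<Rightarrow> bool" where
  "primitive_element R a \<longleftrightarrow>
     a \<in> carrier (mult_of R) \<and> generate (mult_of R) {a} = carrier (mult_of R)"

(* The quadratic character is a function on the nonzero elements; it is made total by
   the value 0 elsewhere, so that the value -1 is only ever taken at a nonzero element. *)
definition quadratic_character :: "('a, 'b) ring_scheme \<Rightarrow> 'a \<Rightarrow> int" where
  "quadratic_character R a =
     (if a \<in> carrier (mult_of R)
      then if \<exists>b\<in>carrier R. a = b [^]\<^bsub>R\<^esub> (2::nat) then 1 else -1
      else 0)"

end

theory Submission
  imports Defs "HOL-Decision_Procs.Algebra_Aux"
begin

text \<open>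
  A set of prime powers can be infinite although only one prime occurs in it, and this is how the
  theorem is proved: every \<open>q = 41 ^ (2 * n + 1)\<close> belongs to the set. Since \<open>41 \<equiv> 1 (mod 20)\<close>, so is
  each such \<open>q\<close>; and since \<open>5\<close> divides \<open>41 - 1\<close>, the fifth roots of unity of a field with \<open>q\<close>
  elements all lie in the prime field: they are the residues of the powers \<open>1, 10, 18, 16, 37\<close> of
  \<open>10\<close> modulo \<open>41\<close> (lemma \<open>root_of_unity_in_prime_field\<close>). Whatever primitive element is chosen,
  \<open>h\<close> is one of the last four, so \<open>1 + h\<close> is the residue of \<open>11\<close>, \<open>19\<close>, \<open>17\<close> or \<open>38\<close>. All four are
  quadratic non-residues modulo \<open>41\<close>, and a non-residue stays a non-square in an extension of odd
  degree (lemma \<open>nonresidue_not_square_odd_degree\<close>).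
\<close>

lemma odd_power_eq_1_plus_odd_multiple:
  fixes p :: nat
  assumes "odd p" "odd k"
  obtains m where "odd m" "p ^ k = 1 + (p - 1) * m"
proof -
  obtain r where p: "p = Suc r" using \<open>odd p\<close> by (cases p) auto
  have "\<exists>m. odd m \<and> p ^ (2 * n + 1) = 1 + r * m" for n
  proof (induction n)
    case 0
    then show ?case by (intro exI[of _ 1]) (simp add: p)
  next
    case (Suc n)
    then obtain m where m: "odd m" "p ^ (2 * n + 1) = 1 + r * m" by blast
    have "p ^ (2 * Suc n + 1) = p ^ (2 * n + 1) * p\<^sup>2"
      by (simp add: power2_eq_square)
    also have "\<dots> = 1 + r * (p + 1 + p\<^sup>2 * m)"
      unfolding m(2) by (simp add: p power2_eq_square algebra_simps)
    finally show ?case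
      using m(1) \<open>odd p\<close> by (intro exI[of _ "p + 1 + p\<^sup>2 * m"]) simp
  qed
  with \<open>odd k\<close> that show thesis
    by (metis oddE diff_Suc_1 p)
qed

lemma (in ring) of_int_order_eq_zero: "\<guillemotleft>int (order R)\<guillemotright> = \<zero>"
proof -
  have pow: "\<one> [^]\<^bsub>add_monoid R\<^esub> n = \<guillemotleft>n\<guillemotright>\<^sub>\<nat>" for n :: nat
    by (induction n) (simp_all add: nat_pow_def a_comm)
  have "\<one> [^]\<^bsub>add_monoid R\<^esub> order (add_monoid R) = \<one>\<^bsub>add_monoid R\<^esub>"
    by (rule group.pow_order_eq_1[OF a_group]) simp
  then show ?thesis
    unfolding pow by (simp add: order_def of_integer_def)
qed

lemma (in domain) of_int_eq_zero_iff_prime_dvd: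
  assumes "prime p" and ord: "order R = p ^ k"
  shows "\<guillemotleft>i\<guillemotright> = \<zero> \<longleftrightarrow> int p dvd i"
proof -
  have p0: "\<guillemotleft>int p\<guillemotright> = \<zero>"
    using of_int_order_eq_zero unfolding ord by (simp add: nat_pow_eq_0_iff)
  show ?thesis
  proof
    assume "int p dvd i"
    then show "\<guillemotleft>i\<guillemotright> = \<zero>" by (auto simp: p0)
  next
    assume i: "\<guillemotleft>i\<guillemotright> = \<zero>"
    show "int p dvd i"
    proof (rule ccontr)
      assume "\<not> int p dvd i"
      with \<open>prime p\<close> have "coprime (int p) i" by (simp add: prime_imp_coprime)
      then obtain u v where "u * int p + v * i = 1"
        using bezout_int[of "int p" i] by auto
      then have "\<one> = \<guillemotleft>u * int p + v * i\<guillemotright>" by simp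
      also have "\<dots> = \<zero>" by (simp add: p0 i)
      finally show False using one_not_zero by simp
    qed
  qed
qed

lemma (in domain) of_int_eq_iff_cong_prime:
  assumes "prime p" "order R = p ^ k"
  shows "\<guillemotleft>i\<guillemotright> = \<guillemotleft>j\<guillemotright> \<longleftrightarrow> [i = j] (mod int p)"
  using of_int_eq_zero_iff_prime_dvd[OF assms, of "i - j"]
  by (simp add: eq_diff0 cong_iff_dvd_diff)

text \<open>
  The equation \<open>x ^ d = 1\<close> has at most \<open>d\<close> solutions in a domain, so the powers of \<open>z\<close>, which give
  \<open>d\<close> of them, are all of them.
\<close>

lemma (in domain) root_of_unity_in_prime_field:
  assumes fin: "finite (carrier R)" and p: "prime p" and ord: "order R = p ^ k"
    and d: "d \<noteq> 0" and zd: "[z ^ d = 1] (mod int p)"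
    and inj: "inj_on (\<lambda>i. z ^ i mod int p) {..<d}"
    and x: "x \<in> carrier R" "x [^] d = \<one>"
  obtains i where "i < d" "x = \<guillemotleft>z ^ i\<guillemotright>"
proof -
  let ?roots = "{x \<in> carrier R. x [^] d = \<one>}"
  let ?powers = "(\<lambda>i. \<guillemotleft>z ^ i\<guillemotright>) ` {..<d}"
  have "?powers \<subseteq> ?roots"
  proof clarsimp
    fix i
    have "[(z ^ i) ^ d = 1] (mod int p)"
      using cong_pow[OF zd, of i] by (simp add: power_mult[symmetric] mult.commute)
    then have "\<guillemotleft>(z ^ i) ^ d\<guillemotright> = \<guillemotleft>1\<guillemotright>"
      by (simp only: of_int_eq_iff_cong_prime[OF p ord])
    then show "(\<guillemotleft>z\<guillemotright> [^] i) [^] d = \<one>" by simp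
  qed
  moreover have "card ?powers = d"
  proof (subst card_image)
    show "inj_on (\<lambda>i. \<guillemotleft>z ^ i\<guillemotright>) {..<d}"
      using inj unfolding inj_on_def of_int_eq_iff_cong_prime[OF p ord] cong_def .
  qed simp
  moreover have "card ?roots \<le> d" by (rule num_roots_le_deg[OF fin d])
  ultimately have "?powers = ?roots"
    using fin by (intro card_seteq) auto
  with x have "x \<in> ?powers" by blast
  with that show thesis by blast
qed

text \<open>
  In a field with \<open>p ^ k\<close> elements a non-zero square is killed by the exponent \<open>(p ^ k - 1) / 2\<close>,
  which is \<open>(p - 1) / 2\<close> times the odd number \<open>1 + p + \<dots> + p ^ (k - 1)\<close>. By Euler's criterion the
  hypothesis on \<open>a\<close> says that it is a non-residue modulo \<open>p\<close>; it makes that power an odd power of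
  \<open>-1\<close>.
\<close>

lemma (in field) nonresidue_not_square_odd_degree:
  assumes fin: "finite (carrier R)" and p: "prime p" "odd p" and ord: "order R = p ^ k"
    and k: "odd k" and a: "[a ^ ((p - 1) div 2) = - 1] (mod int p)"
  shows "\<guillemotleft>a\<guillemotright> \<noteq> \<zero>" and "\<not> (\<exists>b\<in>carrier R. \<guillemotleft>a\<guillemotright> = b [^] (2::nat))"
proof -
  let ?e = "(p - 1) div 2"
  have p2: "p > 2" using p prime_gt_1_nat[of p] by (cases "p = 2") auto
  have neg1: "\<guillemotleft>a\<guillemotright> [^] ?e = \<guillemotleft>- 1\<guillemotright>"
    using a of_int_eq_iff_cong_prime[OF p(1) ord, of "a ^ ?e" "- 1"] by simp
  have ne: "\<guillemotleft>- 1\<guillemotright> \<noteq> \<guillemotleft>1\<guillemotright>"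
    unfolding of_int_eq_iff_cong_prime[OF p(1) ord] cong_iff_dvd_diff
    using p2 zdvd_imp_le[of "int p" 2] by auto
  show nz: "\<guillemotleft>a\<guillemotright> \<noteq> \<zero>"
  proof
    assume "\<guillemotleft>a\<guillemotright> = \<zero>"
    then have "\<guillemotleft>- 1\<guillemotright> = \<zero>" using neg1 p2 nat_pow_zero[of ?e] by auto
    then show False
      unfolding of_int_eq_zero_iff_prime_dvd[OF p(1) ord] using p2 by simp
  qed
  show "\<not> (\<exists>b\<in>carrier R. \<guillemotleft>a\<guillemotright> = b [^] (2::nat))"
  proof
    assume "\<exists>b\<in>carrier R. \<guillemotleft>a\<guillemotright> = b [^] (2::nat)"
    then obtain b where b: "b \<in> carrier R" "\<guillemotleft>a\<guillemotright> = b [^] (2::nat)" by blast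
    obtain m where m: "odd m" "p ^ k = 1 + (p - 1) * m"
      using odd_power_eq_1_plus_odd_multiple[OF p(2) k] .
    have "b \<noteq> \<zero>" using nz b by (auto simp: numeral_2_eq_2)
    interpret G: group "mult_of R"
      rewrites "([^]\<^bsub>mult_of R\<^esub>) = (([^]) :: _ \<Rightarrow> nat \<Rightarrow> _)" and "\<one>\<^bsub>mult_of R\<^esub> = \<one>"
      by (rule field_mult_group) (simp_all add: fun_eq_iff nat_pow_def)
    have "b [^] (p ^ k - 1) = \<one>"
      using G.pow_order_eq_1[of b] b \<open>b \<noteq> \<zero>\<close> by (simp add: order_mult_of[OF fin] ord)
    moreover have "p ^ k - 1 = 2 * (?e * m)"
      using m(2) p(2) by simp
    ultimately have "\<one> = b [^] (2 * (?e * m))" by simp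
    also have "\<dots> = (\<guillemotleft>a\<guillemotright> [^] ?e) [^] m"
      using b(1) by (simp add: nat_pow_pow b(2) mult.assoc)
    also have "\<dots> = \<guillemotleft>(- 1) ^ m\<guillemotright>" unfolding neg1 of_int_power ..
    also have "\<dots> = \<guillemotleft>- 1\<guillemotright>" using m(1) by simp
    finally show False using ne by simp
  qed
qed

lemma (in field) primitive_element_pow_eq_one_iff:
  assumes fin: "finite (carrier R)" and prim: "primitive_element R g"
  shows "g [^] n = \<one> \<longleftrightarrow> order R - 1 dvd (n :: nat)"
proof -
  interpret G: group "mult_of R"
    rewrites "([^]\<^bsub>mult_of R\<^esub>) = (([^]) :: _ \<Rightarrow> nat \<Rightarrow> _)" and "\<one>\<^bsub>mult_of R\<^esub> = \<one>"
    by (rule field_mult_group) (simp_all add: fun_eq_iff nat_pow_def)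
  have g: "g \<in> carrier (mult_of R)" "generate (mult_of R) {g} = carrier (mult_of R)"
    using prim by (auto simp: primitive_element_def)
  have "G.ord g = order R - 1"
    using G.generate_pow_card[OF g(1)] g(2) order_mult_of[OF fin] by (simp add: order_def)
  then show ?thesis using G.pow_eq_id[OF g(1)] by simp
qed

lemma (in field) quadratic_character_one_plus_fifth_root_char_41:
  assumes fin: "finite (carrier R)" and ord: "order R = 41 ^ k" and k: "odd k"
    and prim: "primitive_element R g"
  shows "quadratic_character R (\<one> \<oplus> g [^] ((order R - 1) div 5)) = - 1"
proof -
  have p: "prime (41 :: nat)" by simp
  let ?h = "g [^] ((order R - 1) div 5)"
  have g: "g \<in> carrier R" using prim by (simp add: primitive_element_def)
  have "[41 ^ k = (1 :: nat)] (mod 5)"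
    using cong_pow[of "41 :: nat" 1 5 k] by (simp add: cong_def)
  then have dvd: "5 dvd order R - 1"
    unfolding ord by (rule cong_to_1_nat)
  have gt: "order R > 1" unfolding ord using k by (intro one_less_power) (auto elim: oddE)
  have h5: "?h [^] (5 :: nat) = \<one>"
    using primitive_element_pow_eq_one_iff[OF fin prim, of "order R - 1"] dvd g
    by (simp add: nat_pow_pow)
  have h1: "?h \<noteq> \<one>"
    unfolding primitive_element_pow_eq_one_iff[OF fin prim]
    using dvd gt by (auto dest!: dvd_imp_le elim!: dvdE)
  have inj: "inj_on (\<lambda>i. (10 :: int) ^ i mod int 41) {..<5}"
    by (simp add: inj_on_def numeral_eq_Suc lessThan_Suc del: One_nat_def)
  obtain i where i: "i < 5" "?h = \<guillemotleft>10 ^ i\<guillemotright>"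
    using root_of_unity_in_prime_field[OF fin p ord _ _ inj _ h5] g by (auto simp: cong_def)
  with h1 have "i \<noteq> 0" by (intro notI) simp
  with i have "i \<in> {1, 2, 3, 4}" by auto
  \<comment> \<open>By Euler's criterion these four congruences are the non-residuosity of \<open>11\<close>, \<open>19\<close>, \<open>17\<close>, \<open>38\<close>.\<close>
  then have "[(1 + 10 ^ i) ^ ((41 - 1) div 2) = - 1] (mod int 41)"
    by (auto simp: cong_def)
  note nonsquare = nonresidue_not_square_odd_degree[OF fin p _ ord k this]
  have "\<one> \<oplus> ?h = \<guillemotleft>1 + 10 ^ i\<guillemotright>" unfolding i(2) of_int_add of_int_1 ..
  with nonsquare show ?thesis
    by (simp add: quadratic_character_def del: of_int_add of_int_power)
qed

theorem proposition3p3: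
  fixes F :: "nat \<Rightarrow> ('a, 'b) ring_scheme"
    and \<alpha> :: "nat \<Rightarrow> 'a"
    and h :: "nat \<Rightarrow> 'a"
  assumes "\<And>q. primepow q \<Longrightarrow> [q = 1] (mod 20) \<Longrightarrow>
             field (F q) \<and> finite (carrier (F q)) \<and> order (F q) = q"
    and "\<And>q. primepow q \<Longrightarrow> [q = 1] (mod 20) \<Longrightarrow> primitive_element (F q) (\<alpha> q)"
    and "\<And>q. primepow q \<Longrightarrow> [q = 1] (mod 20) \<Longrightarrow>
             h q = \<alpha> q [^]\<^bsub>F q\<^esub> ((q - 1) div 5)"
  shows "infinite {q. primepow q \<and> [q = 1] (mod 20) \<and>
           quadratic_character (F q) (\<one>\<^bsub>F q\<^esub> \<oplus>\<^bsub>F q\<^esub> h q) = -1}"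
proof (rule infinite_super)
  show "range (\<lambda>n. 41 ^ (2 * n + 1)) \<subseteq> {q. primepow q \<and> [q = 1] (mod 20) \<and>
           quadratic_character (F q) (\<one>\<^bsub>F q\<^esub> \<oplus>\<^bsub>F q\<^esub> h q) = -1}"
  proof (rule image_subsetI)
    fix n :: nat
    define q :: nat where "q = 41 ^ (2 * n + 1)"
    have pp: "primepow q" unfolding q_def primepow_def by (intro exI[of _ 41] exI[of _ "2 * n + 1"]) simp
    have q: "[q = 1] (mod 20)"
      using cong_pow[of "41 :: nat" 1 20 "2 * n + 1"] by (simp add: q_def cong_def)
    have "quadratic_character (F q) (\<one>\<^bsub>F q\<^esub> \<oplus>\<^bsub>F q\<^esub> h q) = -1"
      using field.quadratic_character_one_plus_fifth_root_char_41[of "F q" "2 * n + 1" "\<alpha> q"]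
        assms[OF pp q] by (simp add: q_def)
    with pp q show "41 ^ (2 * n + 1) \<in> {q. primepow q \<and> [q = 1] (mod 20) \<and>
           quadratic_character (F q) (\<one>\<^bsub>F q\<^esub> \<oplus>\<^bsub>F q\<^esub> h q) = -1}"
      unfolding q_def by blast
  qed
  show "infinite (range (\<lambda>n. 41 ^ (2 * n + 1) :: nat))"
    by (rule range_inj_infinite) (simp add: inj_def)
qed

end
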